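(* Let $\phi:\mathbb R\to[0,+\infty)$ be a finite-valued Orlicz function with $ces_\phi\neq\{0\}$. If the space $ces_\phi$ is strictly monotone, then $\phi>0$, i.e. $\phi$ takes the value zero only at zero.
   Context: A finite-valued map $\phi:\mathbb R\to[0,+\infty)$ is an Orlicz function if it is even, convex, $\phi(0)=0$ and $\phi(u)\to\infty$ as $u\to\infty$ (it is then automatically continuous). Let $l^0$ be the space of all real sequences $x=(x(i))_{i=1}^\infty$. For $x\in l^0$ put $\sigma x(i)=\frac1i\sum_{j=1}^i|x(j)|$ and $\rho_\phi(x)=\sum_{i=1}^\infty\phi(\sigma x(i))$. The Cesàro–Orlicz sequence space is $ces_\phi=\{x\in l^0:\ \rho_\phi(\lambda x)<\infty\text{ for some }\lambda>0\}$, equipped with the Luxemburg norm $\|x\|_\phi=\inf\{\lambda>0:\rho_\phi(x/\lambda)\le1\}$. A normed sequence space $X\subset l^0$ is strictly monotone if $\|x\|<\|y\|$ for all $x,y\in X$ such that $0\le x\le y$ (coordinatewise) and $x\neq y$. *)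

theory Defs
  imports "HOL-Analysis.Analysis"
begin

text \<open>Sequences are indexed from 0: \<open>x i\<close> is the coordinate usually written \<open>x(i+1)\<close>.\<close>

definition orlicz_function :: "(real \<Rightarrow> real) \<Rightarrow> bool" where
  "orlicz_function \<phi> \<longleftrightarrow>
     (\<forall>u. 0 \<le> \<phi> u) \<and> (\<forall>u. \<phi> (- u) = \<phi> u) \<and> convex_on UNIV \<phi> \<and> \<phi> 0 = 0 \<and>
     filterlim \<phi> at_top at_top"

definition cesaro_mean :: "(nat \<Rightarrow> real) \<Rightarrow> nat \<Rightarrow> real" where
  "cesaro_mean x i = (\<Sum>j\<le>i. \<bar>x j\<bar>) / real (Suc i)"

text \<open>The modular may be infinite, hence it takes values in \<^typ>\<open>ennreal\<close>.\<close>

definition ces_modular :: "(real \<Rightarrow> real) \<Rightarrow> (nat \<Rightarrow> real) \<Rightarrow> ennreal" where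
  "ces_modular \<phi> x = (\<Sum>i. ennreal (\<phi> (cesaro_mean x i)))"

definition ces_space :: "(real \<Rightarrow> real) \<Rightarrow> (nat \<Rightarrow> real) set" where
  "ces_space \<phi> = {x. \<exists>c>0. ces_modular \<phi> (\<lambda>i. c * x i) < \<infinity>}"

text \<open>A norm only on \<^term>\<open>ces_space \<phi>\<close>: for other sequences the infimum can be over the
  empty set and carries no meaning.\<close>

definition ces_norm :: "(real \<Rightarrow> real) \<Rightarrow> (nat \<Rightarrow> real) \<Rightarrow> real" where
  "ces_norm \<phi> x = Inf {c. c > 0 \<and> ces_modular \<phi> (\<lambda>i. x i / c) \<le> 1}"

definition strictly_monotone_space :: "(nat \<Rightarrow> real) set \<Rightarrow> ((nat \<Rightarrow> real) \<Rightarrow> real) \<Rightarrow> bool" where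
  "strictly_monotone_space X N \<longleftrightarrow>
     (\<forall>x\<in>X. \<forall>y\<in>X. (\<forall>i. 0 \<le> x i \<and> x i \<le> y i) \<and> x \<noteq> y \<longrightarrow> N x < N y)"

end

theory Submission
  imports Defs
begin

text \<open>If \<open>\<phi>\<close> vanishes on \<open>[-a, a]\<close> for some \<open>a > 0\<close>, take \<open>x = e\<^sub>0\<close> and
  \<open>y = e\<^sub>0 + e\<^sub>n\<close>. The Cesaro means of \<open>x\<close> and \<open>y\<close> agree before \<open>n\<close>, and from \<open>n\<close> on they are
  at most \<open>2 / (n + 1)\<close>. Every \<open>c\<close> admissible in the Luxemburg norm of \<open>x\<close> is at
  least \<open>\<parallel>x\<parallel> > 0\<close>, so for \<open>n\<close> large the tail of \<open>y / c\<close> contributes nothing to the modular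
  and \<open>\<parallel>y\<parallel> \<le> \<parallel>x\<parallel>\<close>.\<close>

text \<open>By convexity, \<phi> on [0, a] lies below the chord joining its two zeros at 0 and
  a.\<close>

lemma orlicz_function_eq_0_between:
  assumes "orlicz_function \<phi>" "\<phi> a = 0" "0 \<le> s" "s \<le> a"
  shows "\<phi> s = 0"
proof (cases "a = 0")
  case False
  with assms have a: "a > 0" by simp
  have conv: "convex_on UNIV \<phi>" and nonneg: "0 \<le> \<phi> s" and zero: "\<phi> 0 = 0"
    using assms(1) by (auto simp: orlicz_function_def)
  have "\<phi> ((1 - s / a) *\<^sub>R 0 + (s / a) *\<^sub>R a) \<le> (1 - s / a) * \<phi> 0 + (s / a) * \<phi> a"
    by (rule convex_onD[OF conv]) (use assms a in auto)
  with a zero nonneg assms(2) show ?thesis by simp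
qed (use assms in auto)

lemma cesaro_mean_mult: "cesaro_mean (\<lambda>i. c * x i) i = \<bar>c\<bar> * cesaro_mean x i"
  by (simp add: cesaro_mean_def abs_mult sum_distrib_left)

lemma cesaro_mean_divide: "cesaro_mean (\<lambda>i. x i / c) i = cesaro_mean x i / \<bar>c\<bar>"
  using cesaro_mean_mult[of "1 / c" x i] by simp

lemma cesaro_mean_nonneg: "0 \<le> cesaro_mean x i"
  by (simp add: cesaro_mean_def sum_nonneg)

lemma cesaro_mean_indicator_le:
  assumes "finite A"
  shows "cesaro_mean (indicator A) i \<le> real (card A) / real (Suc i)"
proof -
  have "(\<Sum>j\<le>i. \<bar>indicator A j :: real\<bar>) = real (card ({..i} \<inter> A))"
    by (simp add: indicator_def sum.If_cases)
  also have "\<dots> \<le> real (card A)"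
    using assms by (simp add: card_mono)
  finally show ?thesis
    unfolding cesaro_mean_def by (intro divide_right_mono) auto
qed

lemma indicator_in_ces_space:
  assumes \<phi>: "orlicz_function \<phi>" and a: "\<phi> a = 0" "a > 0" and A: "finite A"
  shows "indicator A \<in> ces_space \<phi>"
proof -
  \<comment> \<open>All means of the indicator are at most \<open>card A\<close>, so this scaling
    puts them in [0, a], where \<phi> vanishes, and the modular is 0. The summand 1 keeps the
    denominator positive for empty A.\<close>
  define c where "c = a / (real (card A) + 1)"
  have c: "c > 0" using a by (simp add: c_def add_nonneg_pos)
  have "\<phi> (cesaro_mean (\<lambda>j. c * indicator A j) i) = 0" for i
  proof (rule orlicz_function_eq_0_between[OF \<phi> a(1)])
    have "real (card A) / real (Suc i) \<le> real (card A)"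
      by (simp add: divide_le_eq mult_left_mono algebra_simps)
    with cesaro_mean_indicator_le[OF A, of i]
    have "cesaro_mean (indicator A) i \<le> real (card A) + 1" by linarith
    then have "c * cesaro_mean (indicator A) i \<le> c * (real (card A) + 1)"
      using c by (intro mult_left_mono) auto
    also have "\<dots> = a" by (simp add: c_def)
    finally show "cesaro_mean (\<lambda>j. c * indicator A j) i \<le> a"
      using c by (simp add: cesaro_mean_mult)
  qed (rule cesaro_mean_nonneg)
  with c show ?thesis
    unfolding ces_space_def ces_modular_def by (auto intro!: exI[of _ c])
qed

theorem corollary2p2:
  fixes \<phi> :: "real \<Rightarrow> real"
  assumes "orlicz_function \<phi>"
    and "ces_space \<phi> \<noteq> {\<lambda>i. 0}"
    and "strictly_monotone_space (ces_space \<phi>) (ces_norm \<phi>)"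
  shows "\<forall>u. u \<noteq> 0 \<longrightarrow> \<phi> u > 0"
proof (rule ccontr)
  assume "\<not> (\<forall>u. u \<noteq> 0 \<longrightarrow> \<phi> u > 0)"
  then obtain u where u: "u \<noteq> 0" "\<not> \<phi> u > 0" by blast
  define a where "a = \<bar>u\<bar>"
  have a: "a > 0" "\<phi> a = 0"
    using u assms(1) unfolding a_def orlicz_function_def
    by (auto simp: abs_if order.antisym not_less)
  define S where "S x = {c. c > 0 \<and> ces_modular \<phi> (\<lambda>i. x i / c) \<le> 1}" for x
  have bdd: "bdd_below (S x)" for x
    by (rule bdd_belowI[of _ 0]) (auto simp: S_def)
  define x :: "nat \<Rightarrow> real" where "x = indicator {0}"
  have "eventually (\<lambda>u. \<phi> u > 1) at_top"
    using assms(1) by (auto simp: orlicz_function_def filterlim_at_top_dense)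
  then obtain M where M: "\<phi> u > 1" if "u \<ge> M" for u
    by (auto simp: eventually_at_top_linorder)
  \<comment> \<open>M may be negative or zero; the maximum makes \<open>1 / K\<close> a positive
    bound.\<close>
  define K where "K = max M 1"
  have K_pos: "K > 0" by (simp add: K_def)
  have K: "\<phi> u > 1" if "u \<ge> K" for u
    using M that by (auto simp: K_def)
  \<comment> \<open>The first mean of \<open>x / c\<close> is \<open>1 / c\<close>. If c were below
    \<open>1 / K\<close>, this one term would already push the modular above 1.\<close>
  have lower: "1 / K \<le> c" if "c \<in> S x" for c
  proof (rule ccontr)
    assume "\<not> 1 / K \<le> c"
    with that have c: "c > 0" "1 / c \<ge> K"
      using K_pos by (auto simp: S_def field_simps)
    have "ennreal (\<phi> (1 / c)) = ennreal (\<phi> (cesaro_mean (\<lambda>i. x i / c) 0))"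
      using c by (simp add: cesaro_mean_def x_def)
    also have "\<dots> \<le> ces_modular \<phi> (\<lambda>i. x i / c)"
      unfolding ces_modular_def
      using sum_le_suminf[of "\<lambda>i. ennreal (\<phi> (cesaro_mean (\<lambda>i. x i / c) i))" "{0}"] by simp
    also have "\<dots> \<le> 1" using that by (simp add: S_def)
    finally show False using K[OF c(2)] by simp
  qed
  \<comment> \<open>The means of x are at most 1, so those of \<open>a * x\<close> lie in the zero
    interval of \<phi>. Nonemptiness of \<open>S x\<close> is what later allows the two infima to be
    compared.\<close>
  have "1 / a \<in> S x"
  proof -
    have "\<phi> (cesaro_mean (\<lambda>j. x j / (1 / a)) i) = 0" for i
    proof (rule orlicz_function_eq_0_between[OF assms(1) a(2) cesaro_mean_nonneg])
      have "cesaro_mean x i \<le> 1"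
        using cesaro_mean_indicator_le[of "{0}" i]
        by (auto simp: x_def elim!: order_trans)
      then show "cesaro_mean (\<lambda>j. x j / (1 / a)) i \<le> a"
        using a unfolding cesaro_mean_divide by simp
    qed
    with a show ?thesis by (simp add: S_def ces_modular_def)
  qed
  \<comment> \<open>This gives \<open>2 / n \<le> a / K \<le> a * c\<close> for all c in
    \<open>S x\<close> at once, so n does not depend on c.\<close>
  obtain n where n: "real n > max 1 (2 * K / a)"
    using reals_Archimedean2 by blast
  define y :: "nat \<Rightarrow> real" where "y = indicator {0, n}"
  have n0: "n > 0" using n by (cases n) auto
  have "S x \<subseteq> S y"
  proof
    fix c assume c: "c \<in> S x"
    then have c0: "c > 0" by (simp add: S_def)
    \<comment> \<open>Before n the two means coincide; from n on the left side is 0.\<close>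
    have le: "\<phi> (cesaro_mean (\<lambda>j. y j / c) i) \<le> \<phi> (cesaro_mean (\<lambda>j. x j / c) i)" for i
    proof (cases "i < n")
      case True
      then have "cesaro_mean y i = cesaro_mean x i"
        unfolding cesaro_mean_def x_def y_def
        by (intro arg_cong2[where f = "(/)"] sum.cong refl) (auto simp: indicator_def)
      then show ?thesis by (simp add: cesaro_mean_divide)
    next
      case False
      have "cesaro_mean y i \<le> 2 / real (Suc i)"
        using cesaro_mean_indicator_le[of "{0, n}" i] n0 by (simp add: y_def)
      also have "\<dots> \<le> 2 / real n"
        using False n0 by (intro divide_left_mono) auto
      also have "\<dots> \<le> a / K"
        using n a K_pos n0 by (simp add: field_simps)
      also have "\<dots> \<le> a * c"
        using mult_left_mono[OF lower[OF c], of a] a by simp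
      finally have "cesaro_mean (\<lambda>j. y j / c) i \<le> a"
        using c0 by (simp add: cesaro_mean_divide divide_le_eq)
      then have "\<phi> (cesaro_mean (\<lambda>j. y j / c) i) = 0"
        by (intro orlicz_function_eq_0_between[OF assms(1) a(2) cesaro_mean_nonneg])
      then show ?thesis using assms(1) by (simp add: orlicz_function_def)
    qed
    have "ces_modular \<phi> (\<lambda>i. y i / c) \<le> ces_modular \<phi> (\<lambda>i. x i / c)"
      unfolding ces_modular_def by (intro suminf_le ennreal_leI le) auto
    also have "\<dots> \<le> 1" using c by (simp add: S_def)
    finally show "c \<in> S y" using c0 by (simp add: S_def)
  qed
  with \<open>1 / a \<in> S x\<close> have "ces_norm \<phi> y \<le> ces_norm \<phi> x"
    unfolding ces_norm_def S_def[symmetric] by (intro cInf_superset_mono bdd) auto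
  moreover have "ces_norm \<phi> x < ces_norm \<phi> y"
  proof -
    have "x \<in> ces_space \<phi>" "y \<in> ces_space \<phi>"
      unfolding x_def y_def by (intro indicator_in_ces_space[OF assms(1) a(2,1)]; simp)+
    moreover have "\<forall>i. 0 \<le> x i \<and> x i \<le> y i" "x n \<noteq> y n"
      using n0 by (auto simp: x_def y_def indicator_def)
    ultimately show ?thesis
      using assms(3) unfolding strictly_monotone_space_def by metis
  qed
  ultimately show False by simp
qed

end
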